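(* In the single-agent scenario, a social choice function $f:\Theta\rightarrow X$ is strongly implementable if and only if there exists a payment function $P:\Theta\rightarrow\mathbb{Q}$ such that the direct revelation mechanism $\Gamma_{(f,P)}$ is incentive compatible and has no bad equilibria.
   Context: Single-agent scenario: one agent with a finite type set $\Theta$, a finite set $X$ of social choices, and a valuation function $V:X\times\Theta\rightarrow\mathbb{Q}$; a social choice function is $f:\Theta\rightarrow X$. A mechanism $\Gamma=(S,g,P)$ consists of a bid set $S$, an outcome function $g:S\rightarrow X$ and a payment function $P:S\rightarrow\mathbb{Q}$. The utility of the agent of type $\theta$ from bid $s$ is $U^\Gamma(s\mid\theta)=V(g(s),\theta)+P(s)$. A strategy is $\alpha:\Theta\rightarrow S$; it is an equilibrium if $U^\Gamma(\alpha(\theta)\mid\theta)\ge U^\Gamma(\bar s\mid\theta)$ for all $\theta\in\Theta$, $\bar s\in S$. $\Gamma$ strongly implements $f$ if it has at least one equilibrium and every equilibrium $\alpha$ satisfies $g\circ\alpha=f$; $f$ is strongly implementable if some mechanism strongly implements it. The direct revelation mechanism $\Gamma_{(f,P)}$ is $(\Theta,f,P)$ with $P:\Theta\rightarrow\mathbb{Q}$; it is incentive compatible if the identity strategy is an equilibrium; an equilibrium $\alpha$ of $\Gamma_{(f,P)}$ is bad if $f\circ\alpha\neq f$. *)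

theory Defs
  imports Complex_Main "HOL-Library.FuncSet"
begin

text \<open>
  Types and social choices are given by carrier sets \<open>T\<close> and \<open>X\<close>. Functions
  between carriers are total HOL functions of which only the values on the carrier are
  constrained or compared; in particular \<open>g \<circ> \<alpha> = f\<close> is equality on \<open>T\<close>.
\<close>

record ('s, 'x) mechanism =
  bids :: "'s set"
  outcome :: "'s \<Rightarrow> 'x"
  payment :: "'s \<Rightarrow> rat"

definition is_mechanism :: "'x set \<Rightarrow> ('s, 'x) mechanism \<Rightarrow> bool" where
  "is_mechanism X \<Gamma> \<longleftrightarrow> outcome \<Gamma> \<in> bids \<Gamma> \<rightarrow> X"

definition utility :: "('x \<times> 't \<Rightarrow> rat) \<Rightarrow> ('s, 'x) mechanism \<Rightarrow> 's \<Rightarrow> 't \<Rightarrow> rat" where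
  "utility V \<Gamma> s \<theta> = V (outcome \<Gamma> s, \<theta>) + payment \<Gamma> s"

definition is_equilibrium ::
  "'t set \<Rightarrow> ('x \<times> 't \<Rightarrow> rat) \<Rightarrow> ('s, 'x) mechanism \<Rightarrow> ('t \<Rightarrow> 's) \<Rightarrow> bool" where
  "is_equilibrium T V \<Gamma> \<alpha> \<longleftrightarrow>
     \<alpha> \<in> T \<rightarrow> bids \<Gamma> \<and>
     (\<forall>\<theta>\<in>T. \<forall>s\<in>bids \<Gamma>. utility V \<Gamma> (\<alpha> \<theta>) \<theta> \<ge> utility V \<Gamma> s \<theta>)"

definition strongly_implements ::
  "'t set \<Rightarrow> 'x set \<Rightarrow> ('x \<times> 't \<Rightarrow> rat) \<Rightarrow> ('s, 'x) mechanism \<Rightarrow> ('t \<Rightarrow> 'x) \<Rightarrow> bool" where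
  "strongly_implements T X V \<Gamma> f \<longleftrightarrow>
     is_mechanism X \<Gamma> \<and>
     (\<exists>\<alpha>. is_equilibrium T V \<Gamma> \<alpha>) \<and>
     (\<forall>\<alpha>. is_equilibrium T V \<Gamma> \<alpha> \<longrightarrow> (\<forall>\<theta>\<in>T. (outcome \<Gamma> \<circ> \<alpha>) \<theta> = f \<theta>))"

text \<open>
  HOL cannot quantify existentially over the type of the bids inside a formula, so
  implementability is relative to a type \<open>'s\<close> from which the bids are drawn. The bid
  set is an arbitrary, possibly infinite, subset of that type.
\<close>

definition strongly_implementable ::
  "'s itself \<Rightarrow> 't set \<Rightarrow> 'x set \<Rightarrow> ('x \<times> 't \<Rightarrow> rat) \<Rightarrow> ('t \<Rightarrow> 'x) \<Rightarrow> bool" where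
  "strongly_implementable B T X V f \<longleftrightarrow>
     (\<exists>\<Gamma> :: ('s, 'x) mechanism. strongly_implements T X V \<Gamma> f)"

definition direct_mechanism ::
  "'t set \<Rightarrow> ('t \<Rightarrow> 'x) \<Rightarrow> ('t \<Rightarrow> rat) \<Rightarrow> ('t, 'x) mechanism" where
  "direct_mechanism T f P = \<lparr>bids = T, outcome = f, payment = P\<rparr>"

definition incentive_compatible ::
  "'t set \<Rightarrow> ('x \<times> 't \<Rightarrow> rat) \<Rightarrow> ('t \<Rightarrow> 'x) \<Rightarrow> ('t \<Rightarrow> rat) \<Rightarrow> bool" where
  "incentive_compatible T V f P \<longleftrightarrow> is_equilibrium T V (direct_mechanism T f P) id"

definition bad_equilibrium ::
  "'t set \<Rightarrow> ('x \<times> 't \<Rightarrow> rat) \<Rightarrow> ('t \<Rightarrow> 'x) \<Rightarrow> ('t \<Rightarrow> rat) \<Rightarrow> ('t \<Rightarrow> 't) \<Rightarrow> bool" where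
  "bad_equilibrium T V f P \<alpha> \<longleftrightarrow>
     is_equilibrium T V (direct_mechanism T f P) \<alpha> \<and> \<not> (\<forall>\<theta>\<in>T. (f \<circ> \<alpha>) \<theta> = f \<theta>)"

end

theory Submission
  imports Defs
begin

text \<open>
  With a single agent the ordinary revelation principle preserves strong implementation.
  If \<open>\<alpha>\<close> is an equilibrium of \<open>\<Gamma>\<close>, pay a report \<open>\<theta>\<close> what \<open>\<Gamma>\<close> pays the bid \<open>\<alpha> \<theta>\<close>.
  An equilibrium \<open>\<beta>\<close> of the resulting direct mechanism gives every type at least the
  utility of truth-telling, which is the best utility available in \<open>\<Gamma>\<close>; so \<open>\<alpha> \<circ> \<beta>\<close>
  is an equilibrium of \<open>\<Gamma>\<close>, and therefore \<open>f \<circ> \<beta> = f\<close>.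
\<close>

lemma bids_direct_mechanism [simp]: "bids (direct_mechanism T f P) = T"
  by (simp add: direct_mechanism_def)

text \<open>The hypothesis concerns the single report \<open>t\<close>, since \<open>f\<close> is
  known to agree with \<open>outcome \<Gamma> \<circ> \<alpha>\<close> only on
  \<open>T\<close>.\<close>

lemma utility_direct_mechanism:
  assumes "outcome \<Gamma> (\<alpha> t) = f t"
  shows "utility V (direct_mechanism T f (payment \<Gamma> \<circ> \<alpha>)) t \<theta> = utility V \<Gamma> (\<alpha> t) \<theta>"
  using assms by (simp add: utility_def direct_mechanism_def)

text \<open>A report \<open>t\<close> acts like the bid \<open>\<alpha> t\<close>, so every
  deviation from truth-telling is already a deviation from \<open>\<alpha>\<close> in
  \<open>\<Gamma>\<close>.\<close>

lemma is_equilibrium_direct_mechanism_id: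
  assumes "is_equilibrium T V \<Gamma> \<alpha>" and "\<forall>\<theta>\<in>T. outcome \<Gamma> (\<alpha> \<theta>) = f \<theta>"
  shows "is_equilibrium T V (direct_mechanism T f (payment \<Gamma> \<circ> \<alpha>)) id"
proof -
  have "utility V (direct_mechanism T f (payment \<Gamma> \<circ> \<alpha>)) t \<theta> = utility V \<Gamma> (\<alpha> t) \<theta>"
    if "t \<in> T" for t \<theta>
    using assms(2) that by (simp add: utility_direct_mechanism)
  with assms(1) show ?thesis
    by (simp add: is_equilibrium_def Pi_iff)
qed

lemma is_equilibrium_comp:
  assumes \<alpha>: "is_equilibrium T V \<Gamma> \<alpha>" and f: "\<forall>\<theta>\<in>T. outcome \<Gamma> (\<alpha> \<theta>) = f \<theta>"
    and \<beta>: "is_equilibrium T V (direct_mechanism T f (payment \<Gamma> \<circ> \<alpha>)) \<beta>"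
  shows "is_equilibrium T V \<Gamma> (\<alpha> \<circ> \<beta>)"
proof -
  have mem: "\<beta> \<theta> \<in> T" if "\<theta> \<in> T" for \<theta>
    using \<beta> that by (auto simp: is_equilibrium_def)
  have "utility V \<Gamma> s \<theta> \<le> utility V \<Gamma> (\<alpha> (\<beta> \<theta>)) \<theta>" if "\<theta> \<in> T" "s \<in> bids \<Gamma>" for \<theta> s
  proof -
    let ?D = "direct_mechanism T f (payment \<Gamma> \<circ> \<alpha>)"
    have "utility V \<Gamma> s \<theta> \<le> utility V \<Gamma> (\<alpha> \<theta>) \<theta>"
      using \<alpha> that by (simp add: is_equilibrium_def)
    also have "\<dots> = utility V ?D \<theta> \<theta>"
      using f that by (simp add: utility_direct_mechanism)
    \<comment> \<open>The competing report is \<open>\<theta>\<close> itself, that is,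
      truth-telling.\<close>
    also have "\<dots> \<le> utility V ?D (\<beta> \<theta>) \<theta>"
      using \<beta> that by (simp add: is_equilibrium_def)
    also have "\<dots> = utility V \<Gamma> (\<alpha> (\<beta> \<theta>)) \<theta>"
      using f mem that by (simp add: utility_direct_mechanism)
    finally show ?thesis .
  qed
  with \<alpha> mem show ?thesis
    by (auto simp: is_equilibrium_def)
qed

lemma strongly_implements_imp_direct:
  assumes "strongly_implements T X V \<Gamma> f"
  shows "\<exists>P. incentive_compatible T V f P \<and> \<not> (\<exists>\<alpha>. bad_equilibrium T V f P \<alpha>)"
proof -
  obtain \<alpha> where \<alpha>: "is_equilibrium T V \<Gamma> \<alpha>"
    using assms by (auto simp: strongly_implements_def)
  have outcome: "\<forall>\<theta>\<in>T. outcome \<Gamma> (\<gamma> \<theta>) = f \<theta>" if "is_equilibrium T V \<Gamma> \<gamma>" for \<gamma>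
    using assms that by (auto simp: strongly_implements_def)
  have "\<not> bad_equilibrium T V f (payment \<Gamma> \<circ> \<alpha>) \<beta>" for \<beta>
  proof
    assume bad: "bad_equilibrium T V f (payment \<Gamma> \<circ> \<alpha>) \<beta>"
    then have \<beta>: "is_equilibrium T V (direct_mechanism T f (payment \<Gamma> \<circ> \<alpha>)) \<beta>"
      by (simp add: bad_equilibrium_def)
    then have "\<forall>\<theta>\<in>T. \<beta> \<theta> \<in> T"
      by (auto simp: is_equilibrium_def)
    moreover have "\<forall>\<theta>\<in>T. outcome \<Gamma> ((\<alpha> \<circ> \<beta>) \<theta>) = f \<theta>"
      using outcome is_equilibrium_comp[OF \<alpha> outcome[OF \<alpha>] \<beta>] by blast
    \<comment> \<open>As \<open>\<beta> \<theta>\<close> lies in \<open>T\<close>, the outcome of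
      \<open>\<alpha> (\<beta> \<theta>)\<close> is also
      \<open>f (\<beta> \<theta>)\<close>.\<close>
    ultimately have "\<forall>\<theta>\<in>T. f (\<beta> \<theta>) = f \<theta>"
      using outcome[OF \<alpha>] by simp
    with bad show False
      by (simp add: bad_equilibrium_def)
  qed
  moreover have "incentive_compatible T V f (payment \<Gamma> \<circ> \<alpha>)"
    using is_equilibrium_direct_mechanism_id[OF \<alpha> outcome[OF \<alpha>]]
    by (simp add: incentive_compatible_def)
  ultimately show ?thesis
    by blast
qed

text \<open>The identity is the required equilibrium, and the absence of bad equilibria is the
  condition on all equilibria.\<close>

lemma strongly_implements_direct_mechanism:
  assumes "f \<in> T \<rightarrow> X" and "incentive_compatible T V f P"
    and "\<not> (\<exists>\<alpha>. bad_equilibrium T V f P \<alpha>)"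
  shows "strongly_implements T X V (direct_mechanism T f P) f"
  using assms
  by (auto simp: strongly_implements_def is_mechanism_def incentive_compatible_def
      bad_equilibrium_def direct_mechanism_def)

text \<open>The equivalence uses bids in \<open>'t\<close>, where the direct mechanism lives. The
  second conjunct covers bids from an arbitrary type \<open>'s\<close>.\<close>

theorem theorem6:
  fixes T :: "'t set" and X :: "'x set"
    and V :: "'x \<times> 't \<Rightarrow> rat" and f :: "'t \<Rightarrow> 'x"
  assumes "finite T" and "finite X" and "f \<in> T \<rightarrow> X"
  shows "(strongly_implementable TYPE('t) T X V f \<longleftrightarrow>
            (\<exists>P :: 't \<Rightarrow> rat. incentive_compatible T V f P \<and> \<not> (\<exists>\<alpha>. bad_equilibrium T V f P \<alpha>)))
       \<and> (strongly_implementable TYPE('s) T X V f \<longrightarrow>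
            (\<exists>P :: 't \<Rightarrow> rat. incentive_compatible T V f P \<and> \<not> (\<exists>\<alpha>. bad_equilibrium T V f P \<alpha>)))"
  using strongly_implements_imp_direct strongly_implements_direct_mechanism[OF assms(3)]
  unfolding strongly_implementable_def by meson

end
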